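(* Let $\mathbb{F}$ be a finite field, $\mathcal{C}_1\subset\mathcal{C}\subseteq\mathbb{F}^n$ linear codes with $\dim\mathcal{C}/\mathcal{C}_1=1$, and $\mathcal{D}=\mathcal{C}^\perp\subset\mathcal{D}_1=\mathcal{C}_1^\perp$. Let $a_1,\ldots,a_w,b_1,\ldots,b_w\in\mathbb{F}^n$ satisfy $a_i\ast b_j\in\mathcal{D}$ for $i+j\leq w$ and $a_i\ast b_j\in\mathcal{D}_1\setminus\mathcal{D}$ for $i+j=w+1$, and fix $x\in\mathcal{D}_1\setminus\mathcal{D}$ such that $a_i\ast b_{w+1-i}\in x+\mathcal{D}$ for $i=1,\ldots,w$. Let $t$ be an integer with $2t<w$ (so $w\le d(\mathcal{C}/\mathcal{C}_1)$). Put $A_i=a_i+\langle a_1,\ldots,a_{i-1}\rangle$ and $B_{w+1-i}=b_{w+1-i}+\langle b_1,\ldots,b_{w-i}\rangle$. For $y\in\mathbb{F}^n$ with $d(y,\mathcal{C})\leq t$ let \[ I=\{1\leq i\leq w:\ \exists\,a_i'\in A_i \text{ with } (a_i'\ast b_j)\cdot y=0 \text{ for } 1\leq j\leq w-i\}, \] \[ I^\ast=\{1\leq j\leq w:\ \exists\,b_j'\in B_{w+1-j} \text{ with } (a_i\ast b_j')\cdot y=0 \text{ for } 1\leq i\leq j-1\}. \] For $i\in I\cap I^\ast$ let $a_i'$, $b_i'$ be vectors witnessing $i\in I$ and $i\in I^\ast$ respectively. Then for every $c\in\mathcal{C}$ with $d(y,c)\leq t$, the equality $x\cdot c=(a_i'\ast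 b_i')\cdot y$ holds for a (strict) majority of the indices $i\in I\cap I^\ast$.
   Context: $\cdot$ is the standard inner product on $\mathbb{F}^n$, $\ast$ the coordinatewise product, $d$ the Hamming distance, $d(y,\mathcal{C})=\min_{c\in\mathcal{C}}d(y,c)$, and $d(\mathcal{C}/\mathcal{C}_1)=\min\{d(c,0):c\in\mathcal{C}\setminus\mathcal{C}_1\}$. Since $x\cdot c$ determines the coset $c+\mathcal{C}_1$, the statement gives a majority-vote procedure recovering the unique coset within distance $t$ of $y$. *)

theory Defs
  imports "HOL-Analysis.Analysis"
begin

text \<open>
  \<open>\<bbbF>\<^sup>n\<close> is \<^typ>\<open>'a ^ 'n\<close> with \<open>'a\<close> a finite field; the standard inner product is
  \<^const>\<open>scalar_product\<close>, and the coordinatewise product is multiplication on \<^typ>\<open>'a ^ 'n\<close>.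
\<close>

definition hamming_dist :: "'a ^ 'n \<Rightarrow> 'a ^ 'n \<Rightarrow> nat" where
  "hamming_dist u v = card {k. u $ k \<noteq> v $ k}"

definition dist_to_code :: "'a::finite ^ 'n \<Rightarrow> ('a ^ 'n) set \<Rightarrow> nat" where
  "dist_to_code y C = Min (hamming_dist y ` C)"

definition coset_dist :: "('a::{field,finite} ^ 'n) set \<Rightarrow> ('a ^ 'n) set \<Rightarrow> nat" where
  "coset_dist C C1 = Min ((\<lambda>c. hamming_dist c 0) ` (C - C1))"

definition dual_code :: "('a::field ^ 'n) set \<Rightarrow> ('a ^ 'n) set" where
  "dual_code C = {v. \<forall>c\<in>C. scalar_product v c = 0}"

text \<open>
  \<open>span_coset a i\<close> is \<open>a\<^sub>i + \<langle>a\<^sub>1, \<dots>, a\<^sub>i\<^sub>-\<^sub>1\<rangle>\<close>; sequences are indexed from 1, the value at 0 is ignored.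
\<close>

definition span_coset :: "(nat \<Rightarrow> 'a::field ^ 'n) \<Rightarrow> nat \<Rightarrow> ('a ^ 'n) set" where
  "span_coset a i = (+) (a i) ` vec.span (a ` {1..<i})"

definition witness_I ::
  "(nat \<Rightarrow> 'a::field ^ 'n) \<Rightarrow> (nat \<Rightarrow> 'a ^ 'n) \<Rightarrow> nat \<Rightarrow> 'a ^ 'n \<Rightarrow> nat \<Rightarrow> 'a ^ 'n \<Rightarrow> bool" where
  "witness_I a b w y i a' \<longleftrightarrow>
     a' \<in> span_coset a i \<and> (\<forall>j\<in>{1..w - i}. scalar_product (a' * b j) y = 0)"

definition witness_Istar ::
  "(nat \<Rightarrow> 'a::field ^ 'n) \<Rightarrow> (nat \<Rightarrow> 'a ^ 'n) \<Rightarrow> nat \<Rightarrow> 'a ^ 'n \<Rightarrow> nat \<Rightarrow> 'a ^ 'n \<Rightarrow> bool" where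
  "witness_Istar a b w y j b' \<longleftrightarrow>
     b' \<in> span_coset b (w + 1 - j) \<and> (\<forall>i\<in>{1..j - 1}. scalar_product (a i * b') y = 0)"

definition set_I ::
  "(nat \<Rightarrow> 'a::field ^ 'n) \<Rightarrow> (nat \<Rightarrow> 'a ^ 'n) \<Rightarrow> nat \<Rightarrow> 'a ^ 'n \<Rightarrow> nat set" where
  "set_I a b w y = {i \<in> {1..w}. \<exists>a'. witness_I a b w y i a'}"

definition set_Istar ::
  "(nat \<Rightarrow> 'a::field ^ 'n) \<Rightarrow> (nat \<Rightarrow> 'a ^ 'n) \<Rightarrow> nat \<Rightarrow> 'a ^ 'n \<Rightarrow> nat set" where
  "set_Istar a b w y = {j \<in> {1..w}. \<exists>b'. witness_Istar a b w y j b'}"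

end

theory Submission
  imports Defs
begin

text \<open>
  Write \<open>y = c + e\<close> with \<open>e\<close> of weight at most \<open>t\<close>. The subspace \<open>\<bbbF>\<^sup>n * e\<close> has dimension the weight of
  \<open>e\<close>, so all but at most \<open>t\<close> indices \<open>i\<close> admit some \<open>a'' \<in> A\<^sub>i\<close> with \<open>a'' * e = 0\<close>. Such an \<open>a''\<close>
  witnesses \<open>i \<in> I\<close>, and if moreover \<open>i \<in> I\<^sup>*\<close>, it shows that \<open>i\<close> votes correctly: the difference
  \<open>a'\<^sub>i - a''\<close> lies in \<open>\<langle>a\<^sub>1, \<dots>, a\<^sub>i\<^sub>-\<^sub>1\<rangle>\<close>, so \<open>(a'\<^sub>i * b'\<^sub>i) \<cdot> e = ((a'\<^sub>i - a'') * b'\<^sub>i) \<cdot> e = 0\<close>.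
  Hence the indices outside \<open>I\<close> and the wrong votes together number at most \<open>t\<close>. Symmetrically, so do
  the indices outside \<open>I\<^sup>*\<close> and the wrong votes. Adding up and using \<open>2 t < w\<close> gives the majority.
  The same dimension count, with \<open>c \<in> C - C\<^sub>1\<close> in place of \<open>e\<close>, bounds the coset distance.
\<close>

section \<open>Weights, orthogonality and coordinatewise products\<close>

lemma hamming_dist_0: "hamming_dist e 0 = card {k. e $ k \<noteq> 0}"
  by (simp add: hamming_dist_def)

lemma hamming_dist_diff:
  fixes u v :: "'a::field ^ 'n"
  shows "hamming_dist (u - v) 0 = hamming_dist u v"
  by (simp add: hamming_dist_def)

lemma scalar_product_add_right:
  fixes u v z :: "'a::field ^ 'n"
  shows "scalar_product u (v + z) = scalar_product u v + scalar_product u z"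
  by (simp add: scalar_product_def distrib_left sum.distrib)

lemma scalar_product_add_left:
  fixes u v z :: "'a::field ^ 'n"
  shows "scalar_product (u + v) z = scalar_product u z + scalar_product v z"
  by (simp add: scalar_product_def distrib_right sum.distrib)

lemma scalar_product_scale_left:
  fixes u z :: "'a::field ^ 'n"
  shows "scalar_product (r *s u) z = r * scalar_product u z"
  by (simp add: scalar_product_def sum_distrib_left mult.assoc)

lemma scalar_product_commute:
  fixes u z :: "'a::field ^ 'n"
  shows "scalar_product u z = scalar_product z u"
  by (simp add: scalar_product_def mult.commute)

lemma scalar_product_mult_eq_0:
  fixes u v e :: "'a::field ^ 'n"
  assumes "u * e = 0"
  shows "scalar_product (u * v) e = 0"
proof -
  have "u $ k * e $ k = 0" for k
    using assms by (metis vector_mult_component zero_index)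
  then have "(u * v) $ k * e $ k = 0" for k
    by auto
  then show ?thesis
    unfolding scalar_product_def by (intro sum.neutral) blast
qed

lemma subspace_scalar_product_eq_0:
  fixes z :: "'a::field ^ 'n"
  shows "vec.subspace {v. scalar_product v z = 0}"
  by (rule vec.subspaceI)
    (auto simp: scalar_product_add_left scalar_product_scale_left scalar_product_def[of 0])

lemma subspace_dual_code:
  fixes C :: "('a::field ^ 'n) set"
  shows "vec.subspace (dual_code C)"
  by (rule vec.subspaceI)
    (auto simp: dual_code_def scalar_product_add_left scalar_product_scale_left
      scalar_product_def[of 0])

lemma linear_mult_vec:
  fixes e :: "'a::field ^ 'n"
  shows "Vector_Spaces.linear (*s) (*s) (\<lambda>v. v * e)"
  by unfold_locales (simp_all add: vec_eq_iff algebra_simps)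

text \<open>The coordinatewise product is bilinear, so induction over one span and then the other
  reduces to generators. \<open>V\<close> will be the dual code or the hyperplane orthogonal to
  \<open>y\<close>; a singleton \<open>S\<close> or \<open>T\<close> covers a fixed factor.\<close>

lemma mult_mem_if_span:
  fixes u v :: "'a::field ^ 'n"
  assumes V: "vec.subspace V" and u: "u \<in> vec.span S" and v: "v \<in> vec.span T"
    and prods: "\<And>s t. s \<in> S \<Longrightarrow> t \<in> T \<Longrightarrow> s * t \<in> V"
  shows "u * v \<in> V"
proof -
  have scale: "(r *s p) * q = r *s (p * q)" "p * (r *s q) = r *s (p * q)"
    for r and p q :: "'a ^ 'n"
    by (simp_all add: vec_eq_iff)
  have right: "s * v \<in> V" if "s \<in> S" for s
    using v
    by (induction rule: vec.span_induct_alt)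
      (auto simp: distrib_left scale vec.subspace_0[OF V]
        intro!: vec.subspace_add[OF V] vec.subspace_scale[OF V] prods that)
  show ?thesis
    using u
    by (induction rule: vec.span_induct_alt)
      (auto simp: distrib_right scale vec.subspace_0[OF V]
        intro!: vec.subspace_add[OF V] vec.subspace_scale[OF V] right)
qed

section \<open>Cosets of spans and the dimension count for annihilators\<close>

lemma span_coset_subset_span:
  assumes "u \<in> span_coset a i" and "1 \<le> i"
  shows "u \<in> vec.span (a ` {1..i})"
proof -
  obtain p where p: "u = a i + p" "p \<in> vec.span (a ` {1..<i})"
    using assms(1) by (auto simp: span_coset_def)
  have "p \<in> vec.span (a ` {1..i})"
    by (rule subsetD[OF vec.span_mono p(2)]) auto
  then show ?thesis
    unfolding p(1) using assms(2) by (intro vec.span_add[OF vec.span_base]) auto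
qed

lemma span_coset_diff:
  assumes "u \<in> span_coset a i" and "v \<in> span_coset a i"
  shows "u - v \<in> vec.span (a ` {1..<i})"
  using assms by (auto simp: span_coset_def intro: vec.span_diff)

text \<open>Multiples of \<open>e\<close> vanish off the support of \<open>e\<close>, so they lie in
  the span of the unit vectors at that support.\<close>

lemma dim_support_le:
  fixes e :: "'a::field ^ 'n"
  assumes "\<And>v. v \<in> V \<Longrightarrow> \<exists>u. v = u * e"
  shows "vec.dim V \<le> hamming_dist e 0"
proof -
  let ?B = "(\<lambda>k. axis k (1::'a)) ` {k. e $ k \<noteq> 0} :: ('a ^ 'n) set"
  have "V \<subseteq> vec.span ?B"
  proof
    fix v assume "v \<in> V"
    then obtain u where u: "v = u * e"
      using assms by blast
    have "(v $ k) *s axis k 1 \<in> vec.span ?B" for k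
      by (cases "e $ k = 0") (auto simp: u vec.span_zero intro: vec.span_scale vec.span_base)
    then have "(\<Sum>k\<in>UNIV. (v $ k) *s axis k 1) \<in> vec.span ?B"
      by (intro vec.span_sum)
    then show "v \<in> vec.span ?B"
      by (simp only: basis_expansion)
  qed
  then have "vec.dim V \<le> card ?B"
    by (intro vec.dim_le_card) auto
  also have "\<dots> \<le> card {k. e $ k \<noteq> 0}"
    by (rule card_image_le) auto
  finally show ?thesis
    by (simp add: hamming_dist_0)
qed

text \<open>The dimension of \<open>\<langle>a\<^sub>1 * e, \<dots>, a\<^sub>m * e\<rangle>\<close> grows at every counted index \<open>m\<close>.\<close>

lemma card_no_annihilator_le_dim:
  fixes a :: "nat \<Rightarrow> 'a::field ^ 'n"
  shows "card {i \<in> {1..m}. \<forall>u \<in> span_coset a i. u * e \<noteq> 0}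
    \<le> vec.dim ((\<lambda>i. a i * e) ` {1..m})"
proof (induction m)
  case 0
  then show ?case by simp
next
  case (Suc m)
  let ?K = "\<lambda>m. {i \<in> {1..m}. \<forall>u \<in> span_coset a i. u * e \<noteq> 0}"
  let ?f = "\<lambda>i. a i * e"
  have img: "?f ` {1..Suc m} = insert (?f (Suc m)) (?f ` {1..m})"
    by (simp add: atLeastAtMostSuc_conv)
  show ?case
  proof (cases "Suc m \<in> ?K (Suc m)")
    case False
    then have "?K (Suc m) = ?K m"
      by (auto simp: le_Suc_eq)
    then have "card (?K (Suc m)) = card (?K m)"
      by (rule arg_cong)
    moreover have "vec.dim (?f ` {1..m}) \<le> vec.dim (?f ` {1..Suc m})"
      unfolding img by (intro vec.dim_subset subset_insertI)
    ultimately show ?thesis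
      using Suc by linarith
  next
    case True
    have "?f (Suc m) \<notin> vec.span (?f ` {1..m})"
    proof
      assume "?f (Suc m) \<in> vec.span (?f ` {1..m})"
      moreover have "vec.span (?f ` {1..m}) = (\<lambda>v. v * e) ` vec.span (a ` {1..m})"
        using vec.linear_span_image[OF linear_mult_vec, of e "a ` {1..m}"]
        by (simp add: image_image)
      ultimately obtain p where p: "p \<in> vec.span (a ` {1..m})" "?f (Suc m) = p * e"
        by auto
      \<comment> \<open>If the new product already lies in the old span, subtracting the preimage
        \<open>p\<close> gives an element of the coset that annihilates \<open>e\<close>,
        contradicting that \<open>Suc m\<close> is counted.\<close>
      have "a (Suc m) + (- p) \<in> span_coset a (Suc m)"
        using p(1) unfolding span_coset_def
        by (intro imageI) (auto simp: atLeastLessThanSuc_atLeastAtMost intro: vec.span_neg)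
      moreover have "(a (Suc m) + (- p)) * e = 0"
        using p(2) by (simp add: left_diff_distrib)
      ultimately show False
        using True by blast
    qed
    then have "vec.dim (?f ` {1..Suc m}) = Suc (vec.dim (?f ` {1..m}))"
      unfolding img by (simp add: vec.dim_insert)
    moreover have "?K (Suc m) \<subseteq> insert (Suc m) (?K m)"
      by (auto simp: le_Suc_eq)
    then have "card (?K (Suc m)) \<le> Suc (card (?K m))"
      using card_mono[of "insert (Suc m) (?K m)" "?K (Suc m)"] by simp
    ultimately show ?thesis
      using Suc by linarith
  qed
qed

lemma card_no_annihilator_le:
  fixes a :: "nat \<Rightarrow> 'a::field ^ 'n"
  shows "card {i \<in> {1..m}. \<forall>u \<in> span_coset a i. u * e \<noteq> 0} \<le> hamming_dist e 0"
  by (rule order_trans[OF card_no_annihilator_le_dim dim_support_le]) auto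

section \<open>Witnesses, errors and the value of a vote\<close>

text \<open>The symmetry of the problem: swapping \<open>a\<close> with \<open>b\<close> and
  reflecting indices by \<open>i\<close> to \<open>w + 1 - i\<close> exchanges the two kinds of
  witnesses, so only one side needs an argument.\<close>

lemma witness_Istar_iff_witness_I:
  assumes "i \<in> {1..w}"
  shows "witness_Istar a b w y i v \<longleftrightarrow> witness_I b a w y (w + 1 - i) v"
proof -
  have "w - (w + 1 - i) = i - 1"
    using assms by auto
  then show ?thesis
    by (simp add: witness_Istar_def witness_I_def mult.commute)
qed

text \<open>For \<open>j\<close> at most \<open>w - i\<close>, the product \<open>u * b j\<close>
  combines products of index sum at most \<open>w\<close>, so it is orthogonal to \<open>c\<close>;
  it is orthogonal to the error \<open>y - c\<close> because \<open>u\<close> annihilates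
  it.\<close>

lemma witness_I_if_annihilator:
  fixes a b :: "nat \<Rightarrow> 'a::field ^ 'n"
  assumes prods: "\<And>i j. i \<in> {1..w} \<Longrightarrow> j \<in> {1..w} \<Longrightarrow> i + j \<le> w \<Longrightarrow> a i * b j \<in> dual_code C"
    and c: "c \<in> C" and i: "i \<in> {1..w}"
    and u: "u \<in> span_coset a i" "u * (y - c) = 0"
  shows "witness_I a b w y i u"
  unfolding witness_I_def
proof (intro conjI u ballI)
  fix j assume j: "j \<in> {1..w - i}"
  have "u * b j \<in> dual_code C"
    by (rule mult_mem_if_span[OF subspace_dual_code span_coset_subset_span[OF u(1)]
          vec.span_base[of _ "{b j}"]]) (use i j in \<open>auto intro!: prods\<close>)
  then have "scalar_product (u * b j) c = 0"
    using c by (simp add: dual_code_def)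
  moreover have "scalar_product (u * b j) (y - c) = 0"
    using u(2) by (rule scalar_product_mult_eq_0)
  ultimately show "scalar_product (u * b j) y = 0"
    using scalar_product_add_right[of "u * b j" c "y - c"] by simp
qed

text \<open>Since \<open>u\<close> annihilates the error, \<open>a'\<close> may be replaced by
  \<open>a' - u\<close>, a combination of the \<open>a k\<close> with \<open>k < i\<close>. Then
  \<open>(a' - u) * b'\<close> is orthogonal to \<open>y\<close> by the choice of \<open>b'\<close>,
  and to \<open>c\<close> because all index sums are at most \<open>w\<close>.\<close>

lemma scalar_product_witnesses_error:
  fixes a b :: "nat \<Rightarrow> 'a::field ^ 'n"
  assumes prods: "\<And>i j. i \<in> {1..w} \<Longrightarrow> j \<in> {1..w} \<Longrightarrow> i + j \<le> w \<Longrightarrow> a i * b j \<in> dual_code C"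
    and c: "c \<in> C" and i: "i \<in> {1..w}"
    and u: "u \<in> span_coset a i" "u * (y - c) = 0"
    and a': "witness_I a b w y i a'" and b': "witness_Istar a b w y i b'"
  shows "scalar_product (a' * b') (y - c) = 0"
proof -
  have diff: "a' - u \<in> vec.span (a ` {1..<i})"
    using a' u(1) unfolding witness_I_def by (blast intro: span_coset_diff)
  have b'_mem: "b' \<in> span_coset b (w + 1 - i)"
    and b'_orth: "\<And>k. k \<in> {1..<i} \<Longrightarrow> scalar_product (a k * b') y = 0"
    using b' by (auto simp: witness_Istar_def)
  have "(a' - u) * b' \<in> dual_code C"
    by (rule mult_mem_if_span[OF subspace_dual_code diff span_coset_subset_span[OF b'_mem]])
      (use i in \<open>auto intro!: prods\<close>)
  then have "scalar_product ((a' - u) * b') c = 0"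
    using c by (simp add: dual_code_def)
  moreover have "(a' - u) * b' \<in> {v. scalar_product v y = 0}"
    by (rule mult_mem_if_span[OF subspace_scalar_product_eq_0 diff vec.span_base[of _ "{b'}"]])
      (use b'_orth in auto)
  ultimately have "scalar_product ((a' - u) * b') (y - c) = 0"
    using scalar_product_add_right[of "(a' - u) * b'" c "y - c"] by simp
  moreover have "scalar_product (u * b') (y - c) = 0"
    using u(2) by (rule scalar_product_mult_eq_0)
  moreover have "a' * b' = (a' - u) * b' + u * b'"
    by (simp add: left_diff_distrib)
  ultimately show ?thesis
    by (simp only: scalar_product_add_left add_0_left)
qed

text \<open>Expanding the product leaves the leading term \<open>a i * b (w + 1 - i)\<close>,
  congruent to \<open>x\<close> modulo the dual code, plus terms of index sum at most
  \<open>w\<close>, which are orthogonal to \<open>c\<close>.\<close>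

lemma scalar_product_span_coset_mult:
  fixes a b :: "nat \<Rightarrow> 'a::field ^ 'n"
  assumes prods: "\<And>i j. i \<in> {1..w} \<Longrightarrow> j \<in> {1..w} \<Longrightarrow> i + j \<le> w \<Longrightarrow> a i * b j \<in> dual_code C"
    and x: "a i * b (w + 1 - i) \<in> (+) x ` dual_code C"
    and c: "c \<in> C" and i: "i \<in> {1..w}"
    and u: "u \<in> span_coset a i" and v: "v \<in> span_coset b (w + 1 - i)"
  shows "scalar_product (u * v) c = scalar_product x c"
proof -
  let ?j = "w + 1 - i"
  obtain p where p: "u = a i + p" "p \<in> vec.span (a ` {1..<i})"
    using u by (auto simp: span_coset_def)
  obtain q where q: "v = b ?j + q" "q \<in> vec.span (b ` {1..<?j})"
    using v by (auto simp: span_coset_def)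
  obtain d where d: "a i * b ?j = x + d" "d \<in> dual_code C"
    using x by auto
  have "p * v \<in> dual_code C"
    by (rule mult_mem_if_span[OF subspace_dual_code p(2) span_coset_subset_span[OF v]])
      (use i in \<open>auto intro!: prods\<close>)
  moreover have "a i * q \<in> dual_code C"
    by (rule mult_mem_if_span[OF subspace_dual_code vec.span_base[of _ "{a i}"] q(2)])
      (use i in \<open>auto intro!: prods\<close>)
  moreover have "u * v = x + (d + (a i * q + p * v))"
    using d(1) by (simp add: p(1) q(1) algebra_simps)
  ultimately show ?thesis
    using c d(2) by (simp add: scalar_product_add_left dual_code_def)
qed

text \<open>By codimension one, \<open>C1\<close> and \<open>c\<close> together span
  \<open>C\<close>. If \<open>x\<close> were orthogonal to \<open>c\<close> as well as to
  \<open>C1\<close>, it would lie in the dual of \<open>C\<close>.\<close>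

lemma scalar_product_nonzero_if_codim_1:
  fixes C C1 :: "('a::field ^ 'n) set"
  assumes C: "vec.subspace C" and C1: "vec.subspace C1" "C1 \<subseteq> C"
    and dim: "vec.dim C = vec.dim C1 + 1"
    and x: "x \<in> dual_code C1 - dual_code C" and c: "c \<in> C - C1"
  shows "scalar_product x c \<noteq> 0"
proof
  assume xc: "scalar_product x c = 0"
  have "c \<notin> vec.span C1"
    using c C1(1) by (metis DiffD2 vec.span_eq_iff)
  then have "vec.dim (insert c C1) = vec.dim C"
    by (simp add: vec.dim_insert dim)
  then have span: "vec.span (insert c C1) = vec.span C"
    using c C1(2) by (intro vec.dim_eq_span) auto
  have "insert c C1 \<subseteq> {v. scalar_product v x = 0}"
    using x xc by (auto simp: dual_code_def scalar_product_commute)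
  then have "vec.span (insert c C1) \<subseteq> {v. scalar_product v x = 0}"
    by (rule vec.span_minimal[OF _ subspace_scalar_product_eq_0])
  then have "C \<subseteq> {v. scalar_product v x = 0}"
    unfolding span using vec.span_superset by blast
  then have "x \<in> dual_code C"
    by (auto simp: dual_code_def scalar_product_commute)
  then show False
    using x by simp
qed

section \<open>The coset distance bound and the count of votes\<close>

theorem theoremA1:
  fixes C C1 D D1 :: "('a::{field,finite} ^ 'n) set"
    and a b :: "nat \<Rightarrow> 'a ^ 'n"
    and x :: "'a ^ 'n"
    and w :: nat and t :: int
  assumes "vec.subspace C" and "vec.subspace C1" and "C1 \<subset> C"
    and "vec.dim C = vec.dim C1 + 1"
    and "D = dual_code C" and "D1 = dual_code C1"
    and "\<And>i j. i \<in> {1..w} \<Longrightarrow> j \<in> {1..w} \<Longrightarrow> i + j \<le> w \<Longrightarrow> a i * b j \<in> D"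
    and "\<And>i j. i \<in> {1..w} \<Longrightarrow> j \<in> {1..w} \<Longrightarrow> i + j = w + 1 \<Longrightarrow> a i * b j \<in> D1 - D"
    and "x \<in> D1 - D"
    and "\<And>i. i \<in> {1..w} \<Longrightarrow> a i * b (w + 1 - i) \<in> (+) x ` D"
    and "2 * t < int w"
  shows "w \<le> coset_dist C C1 \<and>
    (\<forall>y :: 'a ^ 'n. int (dist_to_code y C) \<le> t \<longrightarrow>
      (\<forall>a' b' :: nat \<Rightarrow> 'a ^ 'n.
        (\<forall>i \<in> set_I a b w y \<inter> set_Istar a b w y.
           witness_I a b w y i (a' i) \<and> witness_Istar a b w y i (b' i)) \<longrightarrow>
        (\<forall>c\<in>C. int (hamming_dist y c) \<le> t \<longrightarrow>
           2 * card {i \<in> set_I a b w y \<inter> set_Istar a b w y.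
                       scalar_product x c = scalar_product (a' i * b' i) y}
             > card (set_I a b w y \<inter> set_Istar a b w y))))"
proof (intro conjI allI impI ballI)
  have prods: "\<And>i j. i \<in> {1..w} \<Longrightarrow> j \<in> {1..w} \<Longrightarrow> i + j \<le> w \<Longrightarrow> a i * b j \<in> dual_code C"
    and x: "\<And>i. i \<in> {1..w} \<Longrightarrow> a i * b (w + 1 - i) \<in> (+) x ` dual_code C"
    using assms by auto
  have prods': "b i * a j \<in> dual_code C" if "i \<in> {1..w}" "j \<in> {1..w}" "i + j \<le> w" for i j
    using prods[of j i] that by (simp add: mult.commute add.commute)
  \<comment> \<open>An annihilator of \<open>c\<close> in any of the \<open>w\<close> cosets would
    force the inner product of \<open>x\<close> and \<open>c\<close> to be 0. So every index is
    counted in the dimension bound by the weight of \<open>c\<close>.\<close>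
  have "w \<le> hamming_dist c 0" if c: "c \<in> C - C1" for c
  proof -
    have xc: "scalar_product x c \<noteq> 0"
      using assms c by (intro scalar_product_nonzero_if_codim_1[of C C1]) auto
    have "u * c \<noteq> 0" if i: "i \<in> {1..w}" and u: "u \<in> span_coset a i" for i u
    proof
      assume "u * c = 0"
      then have "scalar_product (u * b (w + 1 - i)) c = 0"
        by (rule scalar_product_mult_eq_0)
      moreover have "b (w + 1 - i) \<in> span_coset b (w + 1 - i)"
        unfolding span_coset_def by (rule image_eqI[of _ _ 0]) (auto simp: vec.span_zero)
      moreover have "c \<in> C"
        using c by simp
      ultimately have "scalar_product x c = 0"
        using scalar_product_span_coset_mult
          [where a = a and b = b and v = "b (w + 1 - i)", OF prods x[OF i] _ i u] by simp
      then show False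
        using xc by simp
    qed
    then have "{i \<in> {1..w}. \<forall>u \<in> span_coset a i. u * c \<noteq> 0} = {1..w}"
      by blast
    then show ?thesis
      using card_no_annihilator_le[of w a c] by simp
  qed
  \<comment> \<open>Strict inclusion makes the minimum in \<open>coset_dist\<close> range over a
    nonempty set.\<close>
  moreover have "C - C1 \<noteq> {}"
    using assms(3) by blast
  ultimately show "w \<le> coset_dist C C1"
    by (simp add: coset_dist_def)

  fix y :: "'a ^ 'n" and a' b' :: "nat \<Rightarrow> 'a ^ 'n" and c :: "'a ^ 'n"
  let ?I = "set_I a b w y" and ?I' = "set_Istar a b w y"
  let ?G = "{i \<in> ?I \<inter> ?I'. scalar_product x c = scalar_product (a' i * b' i) y}"
  assume wit: "\<forall>i \<in> ?I \<inter> ?I'. witness_I a b w y i (a' i) \<and> witness_Istar a b w y i (b' i)"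
    and c: "c \<in> C" and dist: "int (hamming_dist y c) \<le> t"
  define e where "e = y - c"
  have sub: "?I \<subseteq> {1..w}" "?I' \<subseteq> {1..w}"
    by (auto simp: set_I_def set_Istar_def)
  then have fin: "finite ?I" "finite ?I'"
    using finite_subset by blast+
  \<comment> \<open>The vote at \<open>i\<close> equals the inner product of \<open>x\<close> and
    \<open>c\<close> plus an error term, so it is correct once the error term vanishes.\<close>
  have good: "i \<in> ?G" if i: "i \<in> ?I \<inter> ?I'" and err: "scalar_product (a' i * b' i) e = 0" for i
  proof -
    have "i \<in> {1..w}"
      using i sub by blast
    moreover have "a' i \<in> span_coset a i" "b' i \<in> span_coset b (w + 1 - i)"
      using wit i by (auto simp: witness_I_def witness_Istar_def)
    ultimately have "scalar_product (a' i * b' i) c = scalar_product x c"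
      by (intro scalar_product_span_coset_mult[where a = a and b = b, OF prods x c])
    then show ?thesis
      using i err scalar_product_add_right[of "a' i * b' i" c e] by (simp add: e_def)
  qed

  \<comment> \<open>The map \<open>f\<close> carries indices of cosets to indices of votes: the
    identity for \<open>a\<close>, the reflection \<open>w + 1 - j\<close> for
    \<open>b\<close>.\<close>
  have card_le: "card K \<le> nat t" if "K \<subseteq> f ` {i \<in> {1..w}. \<forall>u \<in> span_coset s i. u * e \<noteq> 0}"
    for K and f :: "nat \<Rightarrow> nat" and s
  proof -
    let ?N = "{i \<in> {1..w}. \<forall>u \<in> span_coset s i. u * e \<noteq> 0}"
    have "card K \<le> card (f ` ?N)"
      using that by (intro card_mono) auto
    also have "\<dots> \<le> card ?N"
      by (rule card_image_le) simp
    also have "\<dots> \<le> hamming_dist e 0"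
      by (rule card_no_annihilator_le)
    also have "\<dots> \<le> nat t"
      using dist by (simp add: e_def hamming_dist_diff)
    finally show ?thesis .
  qed

  \<comment> \<open>An annihilator \<open>u\<close> of the error at \<open>i\<close> would put
    \<open>i\<close> into \<open>?I\<close>, leaving only the case of a wrong vote, which
    \<open>u\<close> also excludes.\<close>
  have "({1..w} - ?I) \<union> (?I \<inter> ?I' - ?G) \<subseteq> id ` {i \<in> {1..w}. \<forall>u \<in> span_coset a i. u * e \<noteq> 0}"
  proof
    fix i assume i: "i \<in> ({1..w} - ?I) \<union> (?I \<inter> ?I' - ?G)"
    have iw: "i \<in> {1..w}"
      using i sub by blast
    have "u * e \<noteq> 0" if u: "u \<in> span_coset a i" for u
    proof
      assume "u * e = 0"
      then have ue: "u * (y - c) = 0"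
        by (simp add: e_def)
      have "i \<in> ?I"
        using witness_I_if_annihilator
          [where a = a and b = b, OF prods c iw u ue] iw by (auto simp: set_I_def)
      then have II: "i \<in> ?I \<inter> ?I'" "i \<notin> ?G"
        using i by blast+
      have "scalar_product (a' i * b' i) e = 0"
        using scalar_product_witnesses_error
          [where a = a and b = b, OF prods c iw u ue] wit II(1) by (auto simp: e_def)
      then show False
        using good II by blast
    qed
    then show "i \<in> id ` {i \<in> {1..w}. \<forall>u \<in> span_coset a i. u * e \<noteq> 0}"
      using iw by simp
  qed
  then have left: "card (({1..w} - ?I) \<union> (?I \<inter> ?I' - ?G)) \<le> nat t"
    by (rule card_le)

  have "({1..w} - ?I') \<union> (?I \<inter> ?I' - ?G)
    \<subseteq> (\<lambda>j. w + 1 - j) ` {j \<in> {1..w}. \<forall>u \<in> span_coset b j. u * e \<noteq> 0}"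
  proof
    fix i assume i: "i \<in> ({1..w} - ?I') \<union> (?I \<inter> ?I' - ?G)"
    let ?j = "w + 1 - i"
    have iw: "i \<in> {1..w}"
      using i sub by blast
    then have jw: "?j \<in> {1..w}" and ji: "w + 1 - ?j = i"
      by auto
    have "u * e \<noteq> 0" if u: "u \<in> span_coset b ?j" for u
    proof
      assume "u * e = 0"
      then have ue: "u * (y - c) = 0"
        by (simp add: e_def)
      have "i \<in> ?I'"
        using witness_I_if_annihilator
          [where a = b and b = a, OF prods' c jw u ue] iw
        by (auto simp: set_Istar_def witness_Istar_iff_witness_I)
      then have II: "i \<in> ?I \<inter> ?I'" "i \<notin> ?G"
        using i by blast+
      \<comment> \<open>After the swap, \<open>b' i\<close> and \<open>a' i\<close> exchange their
        roles as witnesses at the reflected index.\<close>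
      have "witness_I b a w y ?j (b' i)" "witness_Istar b a w y ?j (a' i)"
        using wit II(1) witness_Istar_iff_witness_I[OF iw, of a b]
          witness_Istar_iff_witness_I[OF jw, of b a] by (auto simp only: ji)
      then have "scalar_product (b' i * a' i) e = 0"
        using scalar_product_witnesses_error
          [where a = b and b = a, OF prods' c jw u ue] by (simp add: e_def)
      then show False
        using good[OF II(1)] II(2) by (simp add: mult.commute[of "b' i"])
    qed
    then show "i \<in> (\<lambda>j. w + 1 - j) ` {j \<in> {1..w}. \<forall>u \<in> span_coset b j. u * e \<noteq> 0}"
      using jw ji by (intro image_eqI[of _ _ ?j]) auto
  qed
  then have right: "card (({1..w} - ?I') \<union> (?I \<inter> ?I' - ?G)) \<le> nat t"
    by (rule card_le)

  \<comment> \<open>Wrong votes occur only inside \<open>?I \<inter> ?I'\<close>, so both unions are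
    disjoint.\<close>
  have "card (({1..w} - ?I) \<union> (?I \<inter> ?I' - ?G)) = card ({1..w} - ?I) + card (?I \<inter> ?I' - ?G)"
    "card (({1..w} - ?I') \<union> (?I \<inter> ?I' - ?G)) = card ({1..w} - ?I') + card (?I \<inter> ?I' - ?G)"
    using fin by (auto intro!: card_Un_disjoint)
  moreover have "w \<le> card (?I \<inter> ?I') + (card ({1..w} - ?I) + card ({1..w} - ?I'))"
  proof -
    have "card {1..w} \<le> card (?I \<inter> ?I' \<union> (({1..w} - ?I) \<union> ({1..w} - ?I')))"
      using fin by (intro card_mono) auto
    also have "\<dots> \<le> card (?I \<inter> ?I') + (card ({1..w} - ?I) + card ({1..w} - ?I'))"
      by (meson card_Un_le add_left_mono order_trans)
    finally show ?thesis
      by simp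
  qed
  moreover have "card (?I \<inter> ?I') = card ?G + card (?I \<inter> ?I' - ?G)"
  proof -
    have "?G \<union> (?I \<inter> ?I' - ?G) = ?I \<inter> ?I'"
      by blast
    then show ?thesis
      using fin card_Un_disjoint[of ?G "?I \<inter> ?I' - ?G"] by simp
  qed
  \<comment> \<open>The integer \<open>t\<close> is nonnegative because it bounds a
    distance.\<close>
  moreover have "2 * nat t < w"
    using assms(11) dist by linarith
  \<comment> \<open>With W wrong votes, at most \<open>t\<close> - W indices are missing from each
    of \<open>?I\<close> and \<open>?I'\<close>. So \<open>?I \<inter> ?I'\<close> has at least
    \<open>w - 2 * t\<close> + 2W elements, which is more than 2W.\<close>
  ultimately show "card (?I \<inter> ?I') < 2 * card ?G"
    using left right by linarith
qed

end
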